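(* The crystallographic $X$-ray transform $f\mapsto Pf$ on smooth functions $f$ on $SO(3)$ has a non-trivial kernel: there exists a smooth function $f\not\equiv0$ on $SO(3)$ with $Pf(x,y)=0$ for all $(x,y)\in S^2\times S^2$.
   Context: For a smooth function $f$ on $SO(3)$ and $(x,y)\in S^2\times S^2$, the Radon transform $\mathcal{R}f(x,y)$ is the average of $f$ over the set $\{g\in SO(3):gy=x\}$; explicitly, fixing $x_0\in S^2$ with stabilizer $SO(2)\subset SO(3)$ and choosing $x',y'\in SO(3)$ with $x'x_0=x$, $y'x_0=y$, $\mathcal{R}f(x,y)=\int_{SO(2)}f(x'h(y')^{-1})\,dh$ with $dh$ the normalized Haar measure on $SO(2)$. The crystallographic $X$-ray transform (pole density function) of $f$ is $$Pf(x,y)=\tfrac12\big(\mathcal{R}f(x,y)+\mathcal{R}f(-x,y)\big),\qquad (x,y)\in S^2\times S^2.$$ *)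

theory Defs
  imports "HOL-Analysis.Analysis" "HOL-Probability.Probability"
begin

section \<open>Smooth functions on the rotation group\<close>

definition SO3 :: "(real^3^3) set" where
  "SO3 = {g. rotation_matrix g}"

text \<open>Only meant for open \<open>S\<close>, as derivatives are taken in the full space; in finite dimension it is
  then the usual class of \<open>k\<close> times continuously differentiable functions.\<close>

primrec Ck_on :: "nat \<Rightarrow> 'a::real_normed_vector set \<Rightarrow> ('a \<Rightarrow> 'b::real_normed_vector) \<Rightarrow> bool" where
  "Ck_on 0 S f \<longleftrightarrow> continuous_on S f"
| "Ck_on (Suc k) S f \<longleftrightarrow>
     (\<forall>x\<in>S. f differentiable (at x)) \<and>
     (\<forall>v. Ck_on k S (\<lambda>x. frechet_derivative f (at x) v))"

definition smooth_on :: "'a::real_normed_vector set \<Rightarrow> ('a \<Rightarrow> 'b::real_normed_vector) \<Rightarrow> bool" where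
  "smooth_on S f \<longleftrightarrow> (\<forall>k. Ck_on k S f)"

text \<open>\<open>SO3\<close> is an embedded submanifold of the space of matrices, so a function on it is smooth iff
  it is locally the restriction of a smooth function of matrices. Only the values
  of \<open>f\<close> on \<open>SO3\<close> matter.\<close>

definition smooth_on_SO3 :: "(real^3^3 \<Rightarrow> real) \<Rightarrow> bool" where
  "smooth_on_SO3 f \<longleftrightarrow>
     (\<forall>g\<in>SO3. \<exists>U F. open U \<and> g \<in> U \<and> smooth_on U F \<and> (\<forall>h\<in>U \<inter> SO3. f h = F h))"

lemma smooth_on_SO3_continuous:
  assumes "smooth_on_SO3 f"
  shows "continuous_on SO3 f"
  unfolding continuous_on_eq_continuous_within
proof
  fix g assume g: "g \<in> SO3"
  then obtain U F where UF: "open U" "g \<in> U" "smooth_on U F" "\<forall>h\<in>U \<inter> SO3. f h = F h"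
    using assms unfolding smooth_on_SO3_def by blast
  have "continuous_on U F"
    using UF(3) unfolding smooth_on_def by (metis Ck_on.simps(1))
  hence "continuous_on (SO3 \<inter> U) F"
    by (rule continuous_on_subset) simp
  hence "continuous_on (SO3 \<inter> U) f"
    by (rule continuous_on_eq) (use UF(4) in auto)
  hence "continuous (at g within SO3 \<inter> U) f"
    using g UF(2) by (auto simp: continuous_on_eq_continuous_within)
  thus "continuous (at g within SO3) f"
    using at_within_nhd[OF UF(2,1), of "SO3 \<inter> U" SO3]
    by (simp add: continuous_within Int_assoc)
qed

section \<open>The stabilizer of the base point and its Haar measure\<close>

definition base_pt :: "real^3" where
  "base_pt = axis 3 1"

definition SO2 :: "(real^3^3) set" where
  "SO2 = {g\<in>SO3. g *v base_pt = base_pt}"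

definition rot :: "real \<Rightarrow> real^3^3" where
  "rot t = vector [vector [cos t, - sin t, 0], vector [sin t, cos t, 0], vector [0, 0, 1]]"

text \<open>The \<open>\<sigma>\<close>-algebra is that of the Borel subsets of \<open>SO2\<close>, so integrals see only values on \<open>SO2\<close>.
  That this is the normalized Haar measure is proved below
  (\<open>prob_space_haar_SO2\<close>, \<open>haar_SO2_invariant\<close>).\<close>

definition haar_SO2 :: "(real^3^3) measure" where
  "haar_SO2 =
     distr (uniform_measure lborel {0..<2 * pi}) (restrict_space borel SO2) rot"

section \<open>The Radon transform and the crystallographic X-ray transform\<close>

text \<open>The value does not depend on the representatives \<open>x'\<close>, \<open>y'\<close>, which exist for unit vectors
  (\<open>SO3_transitive\<close>, \<open>radon_eq\<close> below).\<close>

definition rep :: "real^3 \<Rightarrow> real^3^3" where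
  "rep x = (SOME g. g \<in> SO3 \<and> g *v base_pt = x)"

definition radon :: "(real^3^3 \<Rightarrow> real) \<Rightarrow> real^3 \<Rightarrow> real^3 \<Rightarrow> real" where
  "radon f x y = (LINT h|haar_SO2. f (rep x ** h ** matrix_inv (rep y)))"

definition xray :: "(real^3^3 \<Rightarrow> real) \<Rightarrow> real^3 \<Rightarrow> real^3 \<Rightarrow> real" where
  "xray f x y = 1 / 2 * (radon f x y + radon f (- x) y)"

section \<open>Well-definedness\<close>

lemma SO3_mult: "g \<in> SO3 \<Longrightarrow> h \<in> SO3 \<Longrightarrow> g ** h \<in> SO3"
  by (auto simp: SO3_def rotation_matrix_def orthogonal_matrix_mul det_mul)

lemma SO3_transpose: "g \<in> SO3 \<Longrightarrow> transpose g \<in> SO3"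
  by (auto simp: SO3_def rotation_matrix_def det_transpose)

lemma SO3_transpose_mult:
  "g \<in> SO3 \<Longrightarrow> transpose g ** g = mat 1" "g \<in> SO3 \<Longrightarrow> g ** transpose g = mat 1"
  by (auto simp: SO3_def rotation_matrix_def orthogonal_matrix_def)

lemma SO3_matrix_inv:
  assumes g: "g \<in> SO3"
  shows "matrix_inv g = transpose g"
proof -
  have "g ** transpose g = mat 1 \<and> transpose g ** g = mat 1"
    using SO3_transpose_mult[OF g] by blast
  hence "g ** matrix_inv g = mat 1 \<and> matrix_inv g ** g = mat 1"
    unfolding matrix_inv_def by (rule someI)
  hence inv: "matrix_inv g ** g = mat 1" ..
  have "matrix_inv g = matrix_inv g ** (g ** transpose g)"
    by (simp only: SO3_transpose_mult(2)[OF g] matrix_mul_rid)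
  also have "\<dots> = transpose g"
    by (simp only: matrix_mul_assoc inv matrix_mul_lid)
  finally show ?thesis .
qed

lemma SO3_transitive:
  assumes "x \<in> sphere 0 1"
  shows "\<exists>g\<in>SO3. g *v base_pt = x"
proof -
  have "norm x = 1" using assms by simp
  then obtain A where "rotation_matrix A" "A *v axis 3 1 = x"
    using rotation_matrix_exists_basis[of x 3] by auto
  thus ?thesis by (auto simp: SO3_def base_pt_def)
qed

lemma rep:
  assumes "x \<in> sphere 0 1"
  shows "rep x \<in> SO3" "rep x *v base_pt = x"
  using someI_ex[of "\<lambda>g. g \<in> SO3 \<and> g *v base_pt = x"] SO3_transitive[OF assms]
  by (auto simp: rep_def)

lemma rot_add: "rot (s + t) = rot s ** rot t"
  by (simp add: rot_def matrix_matrix_mult_def vec_eq_iff forall_3 sum_3 cos_add sin_add)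

lemma rot_in_SO2: "rot t \<in> SO2"
proof -
  have "transpose (rot t) ** rot t = mat 1"
    by (simp add: rot_def matrix_matrix_mult_def transpose_def mat_def vec_eq_iff forall_3 sum_3
        flip: power2_eq_square)
  moreover have "det (rot t) = 1"
    by (simp add: rot_def det_3 flip: power2_eq_square)
  moreover have "rot t *v base_pt = base_pt"
    by (simp add: rot_def base_pt_def matrix_vector_mult_def axis_def vec_eq_iff forall_3 sum_3)
  ultimately show ?thesis
    by (simp add: SO2_def SO3_def rotation_matrix_def orthogonal_matrix)
qed

lemma SO2_eq_rot:
  assumes "g \<in> SO2"
  obtains t where "0 \<le> t" "t < 2 * pi" "g = rot t"
proof -
  have g: "g \<in> SO3" "g *v base_pt = base_pt"
    using assms by (auto simp: SO2_def)
  have col: "g$1$3 = 0" "g$2$3 = 0" "g$3$3 = 1"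
    using g(2) by (auto simp: base_pt_def matrix_vector_mult_def axis_def vec_eq_iff forall_3 sum_3)
  have "g ** transpose g = mat 1" "transpose g ** g = mat 1"
    using SO3_transpose_mult[OF g(1)] by auto
  hence row: "(g$3$1)^2 + (g$3$2)^2 + (g$3$3)^2 = 1"
    and c1: "(g$1$1)^2 + (g$2$1)^2 + (g$3$1)^2 = 1"
    and c2: "(g$1$2)^2 + (g$2$2)^2 + (g$3$2)^2 = 1"
    and c12: "g$1$1 * g$1$2 + g$2$1 * g$2$2 + g$3$1 * g$3$2 = 0"
    by (auto simp: matrix_matrix_mult_def transpose_def mat_def vec_eq_iff forall_3 sum_3
        power2_eq_square)
  have r: "g$3$1 = 0" "g$3$2 = 0"
    using row col(3) by (auto simp: add_nonneg_eq_0_iff)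
  have d: "g$1$1 * g$2$2 - g$1$2 * g$2$1 = 1"
    using g(1) r col by (simp add: SO3_def rotation_matrix_def det_3)
  have "(g$1$1 - g$2$2)^2 + (g$2$1 + g$1$2)^2 = 0"
    using c1 c2 d r by (simp add: power2_eq_square algebra_simps)
  hence e: "g$2$2 = g$1$1" "g$1$2 = - g$2$1"
    by (auto simp: add_nonneg_eq_0_iff)
  obtain t where t: "0 \<le> t" "t < 2 * pi" "g$1$1 = cos t" "g$2$1 = sin t"
    using sincos_total_2pi[of "g$1$1" "g$2$1"] c1 r by auto
  have "g = rot t"
    using t e r col by (simp add: rot_def vec_eq_iff forall_3)
  with t show ?thesis using that by blast
qed

lemma rot_periodic: "rot (t + 2 * pi) = rot t"
  by (simp add: rot_def)

lemma rot_measurable: "rot \<in> borel \<rightarrow>\<^sub>M restrict_space borel SO2"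
proof -
  have "continuous_on UNIV (\<lambda>t. rot t $ i $ j)" for i j
    unfolding rot_def using exhaust_3[of i] exhaust_3[of j]
    by (elim disjE) (simp_all add: continuous_intros)
  hence "continuous_on UNIV (\<lambda>t. \<chi> i j. rot t $ i $ j)"
    by (intro continuous_on_vec_lambda)
  hence "rot \<in> borel_measurable borel"
    by (intro borel_measurable_continuous_onI) simp
  thus ?thesis
    by (intro measurable_restrict_space2) (auto simp: rot_in_SO2)
qed

lemma rot_measurable': "rot \<in> uniform_measure lborel A \<rightarrow>\<^sub>M restrict_space borel SO2"
  using rot_measurable by (simp add: measurable_def)

lemma sets_haar_SO2 [measurable_cong]: "sets haar_SO2 = sets (restrict_space borel SO2)"
  and space_haar_SO2: "space haar_SO2 = SO2"
  by (simp_all add: haar_SO2_def space_restrict_space)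

lemma prob_space_haar_SO2: "prob_space haar_SO2"
  unfolding haar_SO2_def
  by (intro prob_space.prob_space_distr prob_space_uniform_measure rot_measurable') auto

lemma emeasure_haar_SO2:
  assumes "A \<in> sets haar_SO2"
  shows "emeasure haar_SO2 A =
           emeasure lborel ({0..<2 * pi} \<inter> {t. rot t \<in> A}) / ennreal (2 * pi)"
    and "{t. rot t \<in> A} \<in> sets borel"
proof -
  have A: "A \<in> sets (restrict_space borel SO2)"
    using assms sets_haar_SO2 by simp
  have v: "rot -` A = {t. rot t \<in> A}" by auto
  show m: "{t. rot t \<in> A} \<in> sets borel"
    using measurable_sets[OF rot_measurable A] by (simp add: v)
  show "emeasure haar_SO2 A =
           emeasure lborel ({0..<2 * pi} \<inter> {t. rot t \<in> A}) / ennreal (2 * pi)"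
    unfolding haar_SO2_def using m
    by (simp add: emeasure_distr[OF rot_measurable' A] v)
qed

lemma SO2_mult: "g \<in> SO2 \<Longrightarrow> h \<in> SO2 \<Longrightarrow> g ** h \<in> SO2"
  by (auto simp: SO2_def SO3_mult simp flip: matrix_vector_mul_assoc)

lemma SO2_commute: "g \<in> SO2 \<Longrightarrow> h \<in> SO2 \<Longrightarrow> g ** h = h ** g"
  by (metis SO2_eq_rot rot_add add.commute)

lemma emeasure_periodic_shift:
  fixes P :: "real set"
  assumes P: "P \<in> sets borel" and per: "\<And>t. p + t \<in> P \<longleftrightarrow> t \<in> P" and s: "0 \<le> s" "s < p"
  shows "emeasure lborel ({0..<p} \<inter> {t. s + t \<in> P}) = emeasure lborel ({0..<p} \<inter> P)"
proof -
  have shift: "emeasure lborel {t. c + t \<in> B} = emeasure lborel B"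
    if B: "B \<in> sets borel" for c :: real and B
  proof -
    have "emeasure lborel B = emeasure (distr lborel borel ((+) c)) B"
      by (simp only: lborel_distr_plus)
    also have "\<dots> = emeasure lborel ((+) c -` B \<inter> space lborel)"
      using B by (intro emeasure_distr) auto
    also have "(+) c -` B \<inter> space lborel = {t. c + t \<in> B}" by auto
    finally show ?thesis ..
  qed
  have "{0..<p} \<inter> {t. s + t \<in> P} = {t. s + t \<in> {s..<p + s} \<inter> P}"
    by auto
  hence "emeasure lborel ({0..<p} \<inter> {t. s + t \<in> P}) = emeasure lborel ({s..<p + s} \<inter> P)"
    using shift[of "{s..<p + s} \<inter> P" s] P by simp
  also have "{s..<p + s} \<inter> P = ({s..<p} \<inter> P) \<union> ({p..<p + s} \<inter> P)"
    using s by auto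
  also have "emeasure lborel \<dots> =
      emeasure lborel ({s..<p} \<inter> P) + emeasure lborel ({p..<p + s} \<inter> P)"
    using P by (subst plus_emeasure) auto
  also have "emeasure lborel ({p..<p + s} \<inter> P) = emeasure lborel {t. p + t \<in> {p..<p + s} \<inter> P}"
    using P by (subst shift) auto
  also have "{t. p + t \<in> {p..<p + s} \<inter> P} = {0..<s} \<inter> P"
    using per by auto
  also have "emeasure lborel ({s..<p} \<inter> P) + emeasure lborel ({0..<s} \<inter> P) =
      emeasure lborel (({s..<p} \<inter> P) \<union> ({0..<s} \<inter> P))"
    using P by (subst plus_emeasure) auto
  also have "({s..<p} \<inter> P) \<union> ({0..<s} \<inter> P) = {0..<p} \<inter> P"
    using s by auto
  finally show ?thesis .
qed

lemma continuous_on_matrix_mult: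
  fixes A B :: "'a::topological_space \<Rightarrow> real^3^3"
  assumes "continuous_on S A" "continuous_on S B"
  shows "continuous_on S (\<lambda>x. A x ** B x)"
  unfolding matrix_matrix_mult_def
  by (intro continuous_on_vec_lambda continuous_on_sum continuous_on_mult
      continuous_on_component assms)

lemma SO2_mult_measurable:
  assumes "g \<in> SO2"
  shows "(**) g \<in> haar_SO2 \<rightarrow>\<^sub>M haar_SO2"
proof -
  have "((**) g :: real^3^3 \<Rightarrow> real^3^3) \<in> borel_measurable borel"
    using continuous_on_matrix_mult[OF continuous_on_const continuous_on_id, of UNIV g]
    by (intro borel_measurable_continuous_onI) simp
  hence "(**) g \<in> restrict_space borel SO2 \<rightarrow>\<^sub>M restrict_space borel SO2"
    by (rule measurable_restrict_space3) (use assms SO2_mult in auto)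
  thus ?thesis
    by (simp cong: measurable_cong_sets add: sets_haar_SO2)
qed

lemma haar_SO2_invariant:
  assumes g: "g \<in> SO2"
  shows "distr haar_SO2 haar_SO2 ((**) g) = haar_SO2"
proof (rule measure_eqI)
  fix A assume "A \<in> sets (distr haar_SO2 haar_SO2 ((**) g))"
  hence A: "A \<in> sets haar_SO2" by simp
  obtain s where s: "0 \<le> s" "s < 2 * pi" "g = rot s"
    using SO2_eq_rot[OF g] by blast
  let ?B = "(**) g -` A \<inter> space haar_SO2"
  have B: "?B \<in> sets haar_SO2"
    by (rule measurable_sets[OF SO2_mult_measurable[OF g] A])
  have "{t. rot t \<in> ?B} = {t. s + t \<in> {t. rot t \<in> A}}"
    by (auto simp: space_haar_SO2 rot_in_SO2 s(3) rot_add)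
  moreover have "2 * pi + t \<in> {t. rot t \<in> A} \<longleftrightarrow> t \<in> {t. rot t \<in> A}" for t
    using rot_periodic[of t] by (simp add: add.commute)
  ultimately have "emeasure haar_SO2 ?B = emeasure haar_SO2 A"
    using emeasure_periodic_shift[OF emeasure_haar_SO2(2)[OF A] _ s(1,2)]
    by (simp only: emeasure_haar_SO2(1)[OF A] emeasure_haar_SO2(1)[OF B])
  thus "emeasure (distr haar_SO2 haar_SO2 ((**) g)) A = emeasure haar_SO2 A"
    by (simp only: emeasure_distr[OF SO2_mult_measurable[OF g] A])
qed simp

lemma SO3_same_image:
  assumes "g \<in> SO3" "h \<in> SO3" "g *v base_pt = h *v base_pt"
  shows "transpose g ** h \<in> SO2"
proof -
  have "(transpose g ** h) *v base_pt = transpose g *v (g *v base_pt)"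
    by (simp only: assms(3) matrix_vector_mul_assoc)
  also have "\<dots> = base_pt"
    by (simp only: matrix_vector_mul_assoc SO3_transpose_mult(1)[OF assms(1)]
        matrix_vector_mul_lid)
  finally show ?thesis
    using assms by (simp add: SO2_def SO3_mult SO3_transpose)
qed

lemma radon_eq:
  assumes f: "continuous_on SO3 f"
    and g: "g \<in> SO3" "g *v base_pt = x" and k: "k \<in> SO3" "k *v base_pt = y"
  shows "radon f x y = (LINT h|haar_SO2. f (g ** h ** matrix_inv k))"
proof -
  have norm: "norm (q *v base_pt) = 1" if "q \<in> SO3" for q
  proof -
    have "orthogonal_transformation ((*v) q)"
      using that by (simp add: SO3_def rotation_matrix_def orthogonal_transformation_matrix
          matrix_vector_mul_linear)
    thus ?thesis
      using orthogonal_transformation_norm[of "(*v) q" base_pt] by (simp add: base_pt_def)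
  qed
  have rx: "rep x \<in> SO3" "rep x *v base_pt = x" and ry: "rep y \<in> SO3" "rep y *v base_pt = y"
    using rep[of x] rep[of y] norm[OF g(1)] norm[OF k(1)] g(2) k(2) by simp_all
  define a where "a = transpose (rep x) ** g"
  define b where "b = transpose k ** rep y"
  have a: "a \<in> SO2" and b: "b \<in> SO2"
    unfolding a_def b_def using SO3_same_image rx ry g k by simp_all
  have ga: "g = rep x ** a"
    by (simp only: a_def matrix_mul_assoc SO3_transpose_mult(2)[OF rx(1)] matrix_mul_lid)
  have kb: "transpose k = b ** transpose (rep y)"
    by (simp only: b_def SO3_transpose_mult(2)[OF ry(1)] matrix_mul_rid
        flip: matrix_mul_assoc)
  define F where "F h = f (rep x ** h ** transpose (rep y))" for h
  have "continuous_on SO2 F"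
    unfolding F_def
    by (rule continuous_on_compose2[OF f])
       (auto intro!: continuous_on_matrix_mult continuous_intros SO3_mult SO3_transpose rx ry
         simp: SO2_def)
  hence F: "F \<in> borel_measurable haar_SO2"
    using borel_measurable_continuous_on_restrict
    by (simp cong: measurable_cong_sets add: sets_haar_SO2)
  have ab: "a ** b \<in> SO2" by (rule SO2_mult[OF a b])
  have "(LINT h|haar_SO2. f (g ** h ** matrix_inv k)) = (LINT h|haar_SO2. F ((a ** b) ** h))"
  proof (rule Bochner_Integration.integral_cong[OF refl])
    fix h assume "h \<in> space haar_SO2"
    hence "h ** b = b ** h"
      using SO2_commute b by (simp add: space_haar_SO2)
    hence "g ** h ** transpose k = rep x ** ((a ** b) ** h) ** transpose (rep y)"
      unfolding ga kb by (metis matrix_mul_assoc)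
    thus "f (g ** h ** matrix_inv k) = F ((a ** b) ** h)"
      by (simp add: F_def SO3_matrix_inv k(1))
  qed
  also have "\<dots> = (LINT h|distr haar_SO2 haar_SO2 ((**) (a ** b)). F h)"
    by (rule integral_distr[OF SO2_mult_measurable[OF ab] F, symmetric])
  also have "\<dots> = radon f x y"
    by (simp add: haar_SO2_invariant[OF ab] radon_def F_def[abs_def] SO3_matrix_inv ry(1))
  finally show ?thesis ..
qed

end

(* Every matrix entry lies in the kernel. The Klein four-group V of diagonal rotation matrices
   contains, besides the identity and the half turn fixing the base point, two half turns sending
   the base point to its negative. Hence, by invariance of the Haar measure, P f(x, y) is the
   average of f over the matrices x' u h y'\<^sup>-\<^sup>1 with u in V and h in SO2. If f is linear, the
   average over u alone is already 0, as the elements of V sum to the zero matrix. *)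

theory Submission
  imports Defs
begin

lemma Ck_on_const: "Ck_on k S (\<lambda>x. c)"
  by (induction k arbitrary: c) auto

text \<open>A bounded linear map is its own derivative at every point, so its directional
  derivatives do not depend on the point and \<open>Ck_on_const\<close> covers all higher
  orders.\<close>

lemma smooth_on_bounded_linear:
  assumes "bounded_linear f"
  shows "smooth_on S f"
proof -
  have "Ck_on k S f" for k
  proof (cases k)
    case 0
    then show ?thesis
      using assms by (simp add: linear_continuous_on)
  next
    case (Suc m)
    have "frechet_derivative f (at x) = f" for x
      using frechet_derivative_at[OF bounded_linear_imp_has_derivative[OF assms]] by metis
    then show ?thesis
      using Suc assms by (simp add: Ck_on_const bounded_linear_imp_differentiable)
  qed
  then show ?thesis
    by (simp add: smooth_on_def)
qed

lemma bounded_linear_entry: "bounded_linear (\<lambda>g :: real^'n^'m. g $ i $ j)"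
  by (rule bounded_linear_compose[OF bounded_linear_vec_nth bounded_linear_vec_nth])

lemma smooth_on_SO3_entry: "smooth_on_SO3 (\<lambda>g. g $ i $ j)"
  unfolding smooth_on_SO3_def
  using smooth_on_bounded_linear[OF bounded_linear_entry] open_UNIV by blast

lemma abs_entry_SO3_le_1:
  assumes "g \<in> SO3"
  shows "\<bar>g $ i $ j\<bar> \<le> 1"
proof -
  have "orthogonal_matrix g"
    using assms by (simp add: SO3_def rotation_matrix_def)
  then have "norm (row i g) = 1"
    by (simp add: orthogonal_matrix_orthonormal_rows)
  then show ?thesis
    using component_le_norm_cart[of "row i g" j] by (simp add: row_def)
qed

text \<open>Entries of rotations are bounded by 1 and the Haar measure is finite. Integrability is
  what allows the four integrals over the cosets to be merged into one.\<close>

lemma integrable_haar_SO2_entry: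
  assumes "g \<in> SO3" "k \<in> SO3"
  shows "integrable haar_SO2 (\<lambda>h. (g ** h ** k) $ i $ j)"
proof (rule finite_measure.integrable_const_bound[where B = 1])
  show "finite_measure haar_SO2"
    by (rule prob_space.finite_measure[OF prob_space_haar_SO2])
  show "AE h in haar_SO2. norm ((g ** h ** k) $ i $ j) \<le> 1"
    using assms by (auto simp: space_haar_SO2 SO2_def intro!: AE_I2 abs_entry_SO3_le_1 SO3_mult)
  have "continuous_on SO2 (\<lambda>h. (g ** h ** k) $ i $ j)"
    by (intro continuous_on_component continuous_on_matrix_mult continuous_intros)
  then show "(\<lambda>h. (g ** h ** k) $ i $ j) \<in> borel_measurable haar_SO2"
    using borel_measurable_continuous_on_restrict
    by (simp cong: measurable_cong_sets add: sets_haar_SO2)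
qed

text \<open>Signs \<open>a\<close>, \<open>b\<close>, \<open>c\<close> with product 1 give exactly
  the four elements of V.\<close>

definition diag3 :: "real \<Rightarrow> real \<Rightarrow> real \<Rightarrow> real^3^3" where
  "diag3 a b c = vector [vector [a, 0, 0], vector [0, b, 0], vector [0, 0, c]]"

lemma diag3_in_SO3:
  assumes "a * a = 1" "b * b = 1" "a * b * c = 1"
  shows "diag3 a b c \<in> SO3"
proof -
  \<comment> \<open>The third sign condition follows from the other two and the determinant.\<close>
  have "c * c = (a * a) * (b * b) * (c * c)"
    using assms by simp
  also have "\<dots> = (a * b * c) * (a * b * c)"
    by (simp add: algebra_simps)
  finally have "c * c = 1"
    using assms by simp
  then have "transpose (diag3 a b c) ** diag3 a b c = mat 1"
    using assms
    by (simp add: diag3_def matrix_matrix_mult_def transpose_def mat_def vec_eq_iff forall_3 sum_3)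
  then show ?thesis
    using assms
    by (simp add: SO3_def rotation_matrix_def orthogonal_matrix diag3_def det_3)
qed

lemma diag3_base_pt: "diag3 a b c *v base_pt = c *\<^sub>R base_pt"
  by (simp add: diag3_def base_pt_def matrix_vector_mult_def axis_def vec_eq_iff forall_3 sum_3)

text \<open>Each diagonal position carries 1 twice and -1 twice.\<close>

lemma klein_four_sum:
  "diag3 1 1 1 + diag3 (- 1) (- 1) 1 + diag3 1 (- 1) (- 1) + diag3 (- 1) 1 (- 1) = 0"
  by (simp add: diag3_def vec_eq_iff forall_3)

lemma xray_entry_eq_0:
  assumes x: "x \<in> sphere 0 1" and y: "y \<in> sphere 0 1"
  shows "xray (\<lambda>g. g $ i $ j) x y = 0"
proof -
  let ?f = "\<lambda>g :: real^3^3. g $ i $ j"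
  define I where "I u = (LINT h|haar_SO2. ?f (rep x ** u ** h ** matrix_inv (rep y)))" for u
  \<comment> \<open>\<open>rep x ** diag3 a b c\<close> is another rotation taking
    \<open>base_pt\<close> to \<open>c *\<^sub>R x\<close>, and \<open>radon_eq\<close> permits any
    such representative. Each sign \<open>c\<close> thus admits two choices of \<open>a\<close> and
    \<open>b\<close>.\<close>
  have radon: "radon ?f (c *\<^sub>R x) y = I (diag3 a b c)"
    and int: "integrable haar_SO2 (\<lambda>h. ?f (rep x ** diag3 a b c ** h ** matrix_inv (rep y)))"
    if "a * a = 1" "b * b = 1" "a * b * c = 1" for a b c
  proof -
    have g: "rep x ** diag3 a b c \<in> SO3"
      using rep[OF x] diag3_in_SO3[OF that] by (simp add: SO3_mult)
    have "rep x ** diag3 a b c *v base_pt = c *\<^sub>R x"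
      using rep(2)[OF x]
      by (simp add: diag3_base_pt matrix_vector_mult_scaleR flip: matrix_vector_mul_assoc)
    then show "radon ?f (c *\<^sub>R x) y = I (diag3 a b c)"
      unfolding I_def
      by (intro radon_eq smooth_on_SO3_continuous smooth_on_SO3_entry g rep y)
    show "integrable haar_SO2 (\<lambda>h. ?f (rep x ** diag3 a b c ** h ** matrix_inv (rep y)))"
      by (intro integrable_haar_SO2_entry g)
        (simp add: SO3_matrix_inv SO3_transpose rep(1)[OF y])
  qed
  \<comment> \<open>The entry of the product is linear in the middle factor, so
    \<open>klein_four_sum\<close> applies before any integration.\<close>
  have sum0: "?f (rep x ** diag3 1 1 1 ** q) + ?f (rep x ** diag3 (- 1) (- 1) 1 ** q)
      + ?f (rep x ** diag3 1 (- 1) (- 1) ** q) + ?f (rep x ** diag3 (- 1) 1 (- 1) ** q) = 0" for q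
  proof -
    have "?f (rep x ** (diag3 1 1 1 + diag3 (- 1) (- 1) 1 + diag3 1 (- 1) (- 1)
        + diag3 (- 1) 1 (- 1)) ** q) = 0"
      unfolding klein_four_sum by (simp add: matrix_matrix_mult_def)
    then show ?thesis
      by (simp add: matrix_matrix_mult_def sum.distrib ring_distribs)
  qed
  \<comment> \<open>The factor 4 makes each Radon transform occur twice, once for each of the two
    elements of V with the matching \<open>c\<close>.\<close>
  have "4 * xray ?f x y = 2 * radon ?f x y + 2 * radon ?f (- x) y"
    by (simp add: xray_def)
  also have "\<dots> = I (diag3 1 1 1) + I (diag3 (- 1) (- 1) 1)
      + I (diag3 1 (- 1) (- 1)) + I (diag3 (- 1) 1 (- 1))"
    using radon[of 1 1 1] radon[of "- 1" "- 1" 1] radon[of 1 "- 1" "- 1"] radon[of "- 1" 1 "- 1"]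
    by simp
  also have "\<dots> = (LINT h|haar_SO2. ?f (rep x ** diag3 1 1 1 ** h ** matrix_inv (rep y))
      + ?f (rep x ** diag3 (- 1) (- 1) 1 ** h ** matrix_inv (rep y))
      + ?f (rep x ** diag3 1 (- 1) (- 1) ** h ** matrix_inv (rep y))
      + ?f (rep x ** diag3 (- 1) 1 (- 1) ** h ** matrix_inv (rep y)))"
    unfolding I_def by (simp add: int)
  also have "\<dots> = 0"
    \<comment> \<open>Reassociating exposes \<open>h ** matrix_inv (rep y)\<close> as the
      \<open>q\<close> of \<open>sum0\<close>, so the integrand vanishes pointwise.\<close>
    using sum0 by (simp flip: matrix_mul_assoc)
  finally show ?thesis
    by simp
qed

theorem mainTheorem5:
  shows "\<exists>f :: real^3^3 \<Rightarrow> real.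
           smooth_on_SO3 f \<and>
           (\<exists>g\<in>SO3. f g \<noteq> 0) \<and>
           (\<forall>x\<in>sphere 0 1. \<forall>y\<in>sphere 0 1. xray f x y = 0)"
proof (intro exI conjI ballI)
  show "smooth_on_SO3 (\<lambda>g. g $ 3 $ 3)"
    by (rule smooth_on_SO3_entry)
  \<comment> \<open>\<open>diag3 1 1 1\<close> is the identity matrix, on which a diagonal entry is
    1.\<close>
  show "\<exists>g\<in>SO3. g $ 3 $ 3 \<noteq> 0"
    using diag3_in_SO3[of 1 1 1] by (intro bexI[of _ "diag3 1 1 1"]) (simp_all add: diag3_def)
  show "xray (\<lambda>g. g $ 3 $ 3) x y = 0" if "x \<in> sphere 0 1" "y \<in> sphere 0 1" for x y
    using that by (rule xray_entry_eq_0)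
qed

end
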